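(* Let $n\ge 2$ and let $f \colon \Omega \to \Omega'$ be a proper, continuous, monotone surjection between open domains in $\mathbb{R}^n$. Then for every open ball $\mathbb{B}^n(y,r)$ whose closure is a compact subset of $\Omega'$, we have \[ H_0(f^{-1}\mathbb{B}^n(y,r);\mathbb{R}) \cong \mathbb{R}, \qquad H_{n-1}(f^{-1}\mathbb{B}^n(y,r);\mathbb{R}) \cong \{0\}, \qquad H_n(f^{-1}\mathbb{B}^n(y,r);\mathbb{R}) \cong \{0\}. \]
   Context: A map is monotone if it is continuous and the preimage of every point is connected. A map $f\colon\Omega\to\Omega'$ is proper if $f^{-1}K$ is compact for every compact $K \subset \Omega'$. $H_k(X;\mathbb{R})$ is the $k$-th singular homology of $X$ with real coefficients. *)

theory Defs
  imports "HOL-Analysis.Analysis" "HOL-Homology.Homology" "HOL-Algebra.AbelCoset" "HOL-Algebra.Module"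
begin

text \<open>
  HOL-Homology provides singular homology with integer coefficients only. The singular
  simplices and their faces are reused here; the chains are taken over the reals.
  Vector spaces are HOL-Algebra modules over \<open>real_ring\<close>; the module record extends
  the ring record, but its fields \<open>mult\<close> and \<open>one\<close> play no role for a module and are
  left undefined.
\<close>

definition real_ring :: "real ring" where
  "real_ring = \<lparr>carrier = UNIV, monoid.mult = (*), one = 1, zero = 0, add = (+)\<rparr>"

definition real_line :: "(real, real) module" where
  "real_line =
     \<lparr>carrier = UNIV, monoid.mult = undefined, one = undefined, zero = 0, add = (+), smult = (*)\<rparr>"

definition zero_space :: "(real, real) module" where
  "zero_space = real_line\<lparr>carrier := {0}\<rparr>"

definition module_isomorphic ::
  "('r, 'x) ring_scheme \<Rightarrow> ('r, 'a, 'y) module_scheme \<Rightarrow> ('r, 'b, 'z) module_scheme \<Rightarrow> bool" where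
  "module_isomorphic R M N \<longleftrightarrow>
     (\<exists>h \<in> iso (add_monoid M) (add_monoid N).
        \<forall>r \<in> carrier R. \<forall>x \<in> carrier M. h (r \<odot>\<^bsub>M\<^esub> x) = r \<odot>\<^bsub>N\<^esub> h x)"

text \<open>
  The quotient by a submodule \<open>N\<close>. The scalar multiple of a coset is written as a union of
  cosets (all of them equal) rather than as a pointwise image, since the latter is not a
  coset when the scalar is zero.
\<close>

definition quotient_module ::
  "('r, 'a) module \<Rightarrow> 'a set \<Rightarrow> ('r, 'a set) module" where
  "quotient_module M N =
     \<lparr>carrier = a_rcosets\<^bsub>M\<^esub> N, monoid.mult = undefined, one = undefined,
      zero = N, add = set_add M, smult = (\<lambda>r A. \<Union>x\<in>A. N +>\<^bsub>M\<^esub> (r \<odot>\<^bsub>M\<^esub> x))\<rparr>"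

type_synonym 'a real_chain = "((nat \<Rightarrow> real) \<Rightarrow> 'a) \<Rightarrow>\<^sub>0 real"

definition real_chain_space :: "nat \<Rightarrow> 'a topology \<Rightarrow> (real, 'a real_chain) module" where
  "real_chain_space p X =
     \<lparr>carrier = {c. Poly_Mapping.keys c \<subseteq> singular_simplex_set p X},
      monoid.mult = undefined, one = undefined, zero = 0, add = (+),
      smult = (\<lambda>r. Poly_Mapping.map ((*) r))\<rparr>"

definition real_chain_boundary :: "nat \<Rightarrow> 'a real_chain \<Rightarrow> 'a real_chain" where
  "real_chain_boundary p c =
     (if p = 0 then 0
      else \<Sum>s\<in>Poly_Mapping.keys c. \<Sum>k\<le>p.
             Poly_Mapping.single (singular_face p k s) ((-1) ^ k * Poly_Mapping.lookup c s))"

definition real_cycle_space :: "nat \<Rightarrow> 'a topology \<Rightarrow> (real, 'a real_chain) module" where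
  "real_cycle_space p X =
     (real_chain_space p X)
       \<lparr>carrier := {c \<in> carrier (real_chain_space p X). real_chain_boundary p c = 0}\<rparr>"

definition real_boundaries :: "nat \<Rightarrow> 'a topology \<Rightarrow> 'a real_chain set" where
  "real_boundaries p X = real_chain_boundary (Suc p) ` carrier (real_chain_space (Suc p) X)"

definition real_homology :: "nat \<Rightarrow> 'a topology \<Rightarrow> (real, 'a real_chain set) module" where
  "real_homology p X = quotient_module (real_cycle_space p X) (real_boundaries p X)"

end

theory Submission
  imports Defs
begin

text \<open>
  Write \<open>U = f\<inverse>(B)\<close> for the open ball \<open>B\<close>, and embed \<open>\<real>\<^sup>n\<close> in the unit sphere \<open>S\<close> of \<open>\<real>\<^sup>n \<times> \<real>\<close>
  as the complement of a point. A proper monotone map pulls connected sets back to connected sets,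
  so \<open>U\<close> and \<open>f\<inverse>(\<partial>B)\<close> are connected; as the frontier of \<open>U\<close> lies in
  \<open>f\<inverse>(\<partial>B)\<close>, the compact set \<open>C = S - U\<close> is connected.
  Instead of Alexander duality, \<open>H\<^sub>n(S - C) = 0\<close> and \<open>H\<^sub>n\<^sub>-\<^sub>1(S - C) = 0\<close>
  are proved over the integers as follows. A cycle in \<open>S - C\<close> has compact support, so \<open>C\<close> may be
  replaced by a finite union of small spherical caps centred in \<open>C\<close>. The complement of a single
  cap is contractible, and Mayer-Vietoris allows one to add the caps one at a time, each one
  meeting the union of the previous ones.
  A real cycle becomes a real combination of integer cycles when its coefficients are
  expanded in a basis of their rational span, so the vanishing carries over to real coefficients.
\<close>

subsection \<open>Integral homology\<close>

text \<open>Passing from groups to individual chains gives access to compact supports and, later, to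
  a change of coefficients.\<close>

lemma trivial_homology_group_iff:
  "trivial_group (homology_group (int p) X) \<longleftrightarrow>
     (\<forall>c. singular_relcycle p X {} c \<longrightarrow> singular_relboundary p X {} c)"
    (is "_ \<longleftrightarrow> ?rhs")
proof -
  have eq: "homologous_rel_set p X {} c = singular_relboundary_set p X {} \<longleftrightarrow>
            singular_relboundary p X {} c" for c
    by (rule homologous_rel_set_eq_relboundary)
  have "trivial_group (homology_group (int p) X) \<longleftrightarrow>
        homologous_rel_set p X {} ` singular_relcycle_set p X {} = {singular_relboundary_set p X {}}"
    by (simp add: trivial_group_def carrier_relative_homology_group)
  also have "\<dots> \<longleftrightarrow> (\<forall>c \<in> singular_relcycle_set p X {}.
      homologous_rel_set p X {} c = singular_relboundary_set p X {})"
  proof -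
    have *: "f ` S = {k} \<longleftrightarrow> (\<forall>c\<in>S. f c = k)" if "S \<noteq> {}" for f :: "'b \<Rightarrow> 'c" and S k
      using that by auto
    have "0 \<in> singular_relcycle_set p X {}"
      by simp
    then show ?thesis
      by (intro *) (rule notI, simp)
  qed
  also have "\<dots> \<longleftrightarrow> ?rhs"
    by (simp add: eq)
  finally show ?thesis .
qed

text \<open>A piece of Mayer-Vietoris, from exactness and excision. The sequence of
  \<open>(X, T)\<close> kills its relative group in degree \<open>p + 1\<close>, excision carries
  this to \<open>(S, S \<inter> T)\<close>, and the sequence of that pair squeezes the group of
  \<open>S \<inter> T\<close> between two trivial ones.\<close>

lemma trivial_homology_group_intersection:
  assumes S: "openin X S" and T: "openin X T" and ST: "S \<union> T = topspace X"
    and X: "trivial_group (homology_group (p + 1) X)"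
    and HS: "trivial_group (homology_group p (subtopology X S))"
    and HT: "trivial_group (homology_group p (subtopology X T))"
  shows "trivial_group (homology_group p (subtopology X (S \<inter> T)))"
proof -
  let ?R = "relative_homology_group (p + 1) X T"
  let ?R' = "relative_homology_group (p + 1) (subtopology X S) (S \<inter> T)"
  have ker: "kernel ?R (homology_group p (subtopology X T)) (hom_boundary (p + 1) X T)
      = hom_induced (p + 1) X {} X T id ` carrier (homology_group (p + 1) X)"
    using homology_exactness_axiom_1[of "p + 1" X T] by simp
  have "carrier ?R \<subseteq> kernel ?R (homology_group p (subtopology X T)) (hom_boundary (p + 1) X T)"
    using HT hom_boundary_carrier[of "p + 1" X T]
    by (auto simp: kernel_def trivial_group_def)
  then have "carrier ?R \<subseteq> {hom_induced (p + 1) X {} X T id \<one>\<^bsub>homology_group (p + 1) X\<^esub>}"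
    using ker X by (simp add: trivial_group_def)
  then have trR: "trivial_group ?R"
    by (simp add: group.trivial_group_subset subset_singleton_iff trivial_group_def)
       (metis group.is_monoid group_relative_homology_group monoid.one_closed singletonD subset_singleton_iff empty_iff)
  \<comment> \<open>The set to excise: closed because \<open>S\<close> is open, and contained in the
    open set \<open>T\<close>.\<close>
  define U where "U = topspace X - S"
  have "X closure_of U = U"
    by (simp add: U_def S closure_of_eq openin_closedin_eq[symmetric] closedin_diff)
  moreover have "X interior_of T = T"
    by (simp add: T interior_of_eq)
  moreover have "U \<subseteq> T"
    using ST U_def by blast
  ultimately have "hom_induced (p + 1) (subtopology X (topspace X - U)) (T - U) (subtopology X (topspace X)) T id
    \<in> iso (relative_homology_group (p + 1) (subtopology X (topspace X - U)) (T - U))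
          (relative_homology_group (p + 1) (subtopology X (topspace X)) T)"
    using T by (intro homology_excision_axiom) (auto simp: openin_subset)
  moreover have "topspace X - U = S" "T - U = S \<inter> T"
    using openin_subset[OF S] openin_subset[OF T] by (auto simp: U_def)
  ultimately have "?R' \<cong> ?R"
    by (metis is_isoI subtopology_topspace)
  then have trR': "trivial_group ?R'"
    using trR isomorphic_group_triviality by (metis group_relative_homology_group)
  let ?H = "homology_group p (subtopology (subtopology X S) (S \<inter> T))"
  have "kernel ?H (homology_group p (subtopology X S))
          (hom_induced p (subtopology (subtopology X S) (S \<inter> T)) {} (subtopology X S) {} id)
      = hom_boundary (p + 1) (subtopology X S) (S \<inter> T) ` carrier ?R'"
    using homology_exactness_axiom_2[of "p + 1" "subtopology X S" "S \<inter> T"] by simp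
  moreover have "carrier ?H \<subseteq> kernel ?H (homology_group p (subtopology X S))
          (hom_induced p (subtopology (subtopology X S) (S \<inter> T)) {} (subtopology X S) {} id)"
    using HS hom_induced_carrier by (fastforce simp: kernel_def trivial_group_def)
  ultimately have "carrier ?H \<subseteq> {hom_boundary (p + 1) (subtopology X S) (S \<inter> T) \<one>\<^bsub>?R'\<^esub>}"
    using trR' by (simp add: trivial_group_def)
  then have "trivial_group ?H"
    by (simp add: trivial_group_def subset_singleton_iff)
       (metis group.is_monoid group_relative_homology_group monoid.one_closed singletonD empty_iff)
  then show ?thesis
    by (simp add: subtopology_subtopology)
qed

section \<open>Cycles with compact support\<close>

lemma singular_chain_compact_support:
  assumes "singular_chain p (top_of_set U) c"
  obtains L where "compact L" "L \<subseteq> U" "singular_chain p (top_of_set L) c"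
proof
  let ?L = "\<Union>f\<in>Poly_Mapping.keys c. f ` standard_simplex p"
  have f: "continuous_map (subtopology (powertop_real UNIV) (standard_simplex p)) (top_of_set U) f"
          "f \<in> extensional (standard_simplex p)"
    if "f \<in> Poly_Mapping.keys c" for f
    using assms that by (auto simp: singular_chain_def singular_simplex_def)
  have "compactin (top_of_set U) (f ` standard_simplex p)" if "f \<in> Poly_Mapping.keys c" for f
    using image_compactin[OF _ f(1)[OF that]] compactin_standard_simplex
    by (simp add: compactin_subtopology)
  then show "compact ?L" "?L \<subseteq> U"
    by (auto simp: compactin_subtopology intro!: compact_UN)
  have "continuous_map (subtopology (powertop_real UNIV) (standard_simplex p)) (top_of_set ?L) f"
    if "f \<in> Poly_Mapping.keys c" for f
    using f(1)[OF that] that by (auto simp: continuous_map_in_subtopology)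
  then show "singular_chain p (top_of_set ?L) c"
    using f(2) by (auto simp: singular_chain_def singular_simplex_def)
qed

text \<open>A cycle supported in \<open>L\<close> bounds inside \<open>V\<close>, hence inside
  \<open>U\<close>. Since \<open>V\<close> may depend on the cycle, \<open>U\<close> can be replaced
  by simpler sets.\<close>

lemma trivial_homology_group_compact_exhaustion:
  assumes "\<And>L. compact L \<Longrightarrow> L \<subseteq> U \<Longrightarrow>
    \<exists>V. L \<subseteq> V \<and> V \<subseteq> U \<and> trivial_group (homology_group (int p) (top_of_set V))"
  shows "trivial_group (homology_group (int p) (top_of_set U))"
  unfolding trivial_homology_group_iff
proof (intro allI impI)
  fix c assume c: "singular_relcycle p (top_of_set U) {} c"
  then have "singular_chain p (top_of_set U) c" and bc: "chain_boundary p c = 0"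
    by (auto simp: singular_cycle)
  then obtain L where L: "compact L" "L \<subseteq> U" "singular_chain p (top_of_set L) c"
    by (meson singular_chain_compact_support)
  then obtain V where V: "L \<subseteq> V" "V \<subseteq> U" "trivial_group (homology_group (int p) (top_of_set V))"
    using assms[OF L(1,2)] by blast
  have "singular_chain p (top_of_set V) c"
    by (rule singular_chain_mono[OF L(3) V(1)])
  then have "singular_relcycle p (top_of_set V) {} c"
    by (simp add: singular_cycle bc)
  then have "singular_relboundary p (top_of_set V) {} c"
    using V(3) unfolding trivial_homology_group_iff by (elim allE impE)
  then show "singular_relboundary p (top_of_set U) {} c"
    by (rule singular_boundary_mono[OF V(2)])
qed

lemma trivial_homology_group_contractible:
  assumes "contractible_space X" "p \<noteq> 0"
  shows "trivial_group (homology_group p X)"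
  using trivial_reduced_homology_group_contractible_space[OF assms(1), of p]
  by (simp only: un_reduced_homology_group[OF assms(2)])

lemma trivial_homology_group_sphere:
  assumes "p \<noteq> 0" "p \<noteq> int DIM('a) - 1"
  shows "trivial_group (homology_group p (top_of_set (sphere (0::'a::euclidean_space) 1)))"
proof -
  have "pairwise orthogonal (Basis :: 'a set)"
    by (simp add: pairwise_def orthogonal_def inner_not_same_Basis)
  then obtain f :: "(nat \<Rightarrow> real) \<Rightarrow> 'a" and g
    where "homeomorphic_maps (nsphere (DIM('a) - 1)) (top_of_set (sphere 0 1 \<inter> span Basis)) f g"
    by (rule homeomorphic_maps_nsphere_euclidean_sphere[of "Basis :: 'a set" "DIM('a)", rotated])
       (auto simp: independent_Basis)
  then have "nsphere (DIM('a) - 1) homeomorphic_space top_of_set (sphere (0::'a) 1)"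
    unfolding homeomorphic_space_def by auto
  then have "homology_group p (nsphere (DIM('a) - 1)) \<cong> homology_group p (top_of_set (sphere (0::'a) 1))"
    by (rule homeomorphic_space_imp_isomorphic_homology_groups)
  moreover have "p \<noteq> int (DIM('a) - 1)"
    using assms(2) by (simp add: of_nat_diff Suc_leI)
  then have "trivial_group (homology_group p (nsphere (DIM('a) - 1)))"
    using trivial_reduced_homology_group_nsphere[of p "DIM('a) - 1"]
    by (simp only: un_reduced_homology_group[OF assms(1)] not_False_eq_True)
  ultimately show ?thesis
    using isomorphic_group_triviality[OF _ group_relative_homology_group group_relative_homology_group]
    by blast
qed

subsection \<open>Complements in the sphere\<close>

text \<open>Pointed cones stand for convex pieces of the sphere. Unlike round caps they are closed
  under intersection, as an induction with Mayer-Vietoris requires; \<open>{0}\<close> stands for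
  the empty piece.\<close>

definition pointed_cone :: "'a::euclidean_space set \<Rightarrow> bool" where
  "pointed_cone K \<longleftrightarrow> closed K \<and> convex_cone K \<and> (\<forall>x\<in>K. - x \<in> K \<longrightarrow> x = 0)"

lemma pointed_cone_Int:
  assumes "pointed_cone K" "pointed_cone L"
  shows "pointed_cone (K \<inter> L)"
  using assms by (auto simp: pointed_cone_def convex_cone_iff)

text \<open>For \<open>t > 0\<close> and a unit vector \<open>c\<close>, the cone over the closed
  spherical cap \<open>t \<le> x \<bullet> c\<close>.\<close>

definition cap_cone :: "real \<Rightarrow> 'a::euclidean_space \<Rightarrow> 'a set" where
  "cap_cone t c = {x. t * norm x \<le> x \<bullet> c}"

lemma closed_cap_cone: "closed (cap_cone t c)"
  unfolding cap_cone_def by (intro closed_Collect_le continuous_intros)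

lemma pointed_cone_cap_cone:
  assumes "t > 0"
  shows "pointed_cone (cap_cone t c)"
  unfolding pointed_cone_def convex_cone_iff
proof (intro conjI ballI allI impI)
  show "closed (cap_cone t c)"
    by (rule closed_cap_cone)
  show "0 \<in> cap_cone t c"
    by (simp add: cap_cone_def)
next
  fix x y :: 'a assume "x \<in> cap_cone t c" "y \<in> cap_cone t c"
  then have "t * (norm x + norm y) \<le> (x + y) \<bullet> c"
    by (simp add: cap_cone_def inner_add_left distrib_left)
  moreover have "t * norm (x + y) \<le> t * (norm x + norm y)"
    using assms norm_triangle_ineq by (intro mult_left_mono) auto
  ultimately show "x + y \<in> cap_cone t c"
    by (simp add: cap_cone_def)
next
  fix x :: 'a and a :: real assume "x \<in> cap_cone t c" "0 \<le> a"
  then have "a * (t * norm x) \<le> a * (x \<bullet> c)"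
    by (intro mult_left_mono) (simp_all add: cap_cone_def)
  then show "a *\<^sub>R x \<in> cap_cone t c"
    using \<open>0 \<le> a\<close> by (simp add: cap_cone_def mult.left_commute)
next
  fix x :: 'a assume "x \<in> cap_cone t c" "- x \<in> cap_cone t c"
  then have "t * norm x \<le> 0"
    by (simp add: cap_cone_def)
  with assms show "x = 0"
    by (simp add: mult_le_0_iff)
qed

text \<open>The homotopy moves \<open>x\<close> along the great circle through \<open>p\<close> away from \<open>p\<close> to \<open>- p\<close>.\<close>

lemma contractible_sphere_minus_cone:
  fixes K :: "'a::euclidean_space set"
  assumes K: "pointed_cone K" and p: "p \<in> K" "norm p = 1"
  shows "contractible (sphere 0 1 - K)"
proof -
  have add: "x + y \<in> K" if "x \<in> K" "y \<in> K" for x y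
    using K that by (simp add: pointed_cone_def convex_cone_iff)
  have scale: "a *\<^sub>R x \<in> K" if "x \<in> K" "0 \<le> a" for a x
    using K that by (simp add: pointed_cone_def convex_cone_iff)
  have np: "- p \<notin> K"
    using K p by (auto simp: pointed_cone_def)
  define v where "v = (\<lambda>(t, x). (1 - t) *\<^sub>R x - t *\<^sub>R p)"
  \<comment> \<open>Adding \<open>t *\<^sub>R p\<close> to \<open>v (t, x)\<close> leaves
    \<open>(1 - t) *\<^sub>R x\<close>, so for \<open>t < 1\<close> entering \<open>K\<close> would
    put \<open>x\<close> into \<open>K\<close>; at \<open>t = 1\<close> the point is
    \<open>- p\<close>, excluded by pointedness.\<close>
  have vK: "v (t, x) \<notin> K" if t: "t \<in> {0..1}" and x: "x \<in> sphere 0 1 - K" for t x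
  proof
    assume v: "v (t, x) \<in> K"
    show False
    proof (cases "t = 1")
      case True
      then show False
        using v np by (simp add: v_def)
    next
      case False
      have "(1 - t) *\<^sub>R x \<in> K"
        using add[OF v scale[OF p(1), of t]] t by (simp add: v_def)
      then have "inverse (1 - t) *\<^sub>R (1 - t) *\<^sub>R x \<in> K"
        using t by (intro scale[of "(1 - t) *\<^sub>R x"]) auto
      moreover have "inverse (1 - t) *\<^sub>R (1 - t) *\<^sub>R x = x"
        using False by simp
      ultimately show False
        using x by simp
    qed
  qed
  \<comment> \<open>As the origin lies in \<open>K\<close>, avoiding \<open>K\<close> also makes the
    normalisation in \<open>h\<close> legitimate.\<close>
  have "0 \<in> K"
    using scale[OF p(1), of 0] by simp
  then have v0: "v z \<noteq> 0" if "z \<in> {0..1} \<times> (sphere 0 1 - K)" for z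
    using vK that by fastforce
  define h where "h = (\<lambda>z. inverse (norm (v z)) *\<^sub>R v z)"
  have "continuous_on ({0..1} \<times> (sphere 0 1 - K)) v"
    unfolding v_def case_prod_unfold by (intro continuous_intros)
  then have conth: "continuous_on ({0..1} \<times> (sphere 0 1 - K)) h"
    unfolding h_def using v0 by (intro continuous_intros) auto
  have him: "h (t, x) \<in> sphere 0 1 - K" if "t \<in> {0..1}" "x \<in> sphere 0 1 - K" for t x
  proof -
    have "v (t, x) \<noteq> 0"
      using v0 that by simp
    moreover have "h (t, x) \<notin> K"
    proof
      assume "h (t, x) \<in> K"
      then have "norm (v (t, x)) *\<^sub>R h (t, x) \<in> K"
        by (intro scale) auto
      then show False
        using vK[OF that] \<open>v (t, x) \<noteq> 0\<close> by (simp add: h_def)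
    qed
    ultimately show ?thesis
      by (simp add: h_def)
  qed
  have "homotopic_with_canon (\<lambda>_. True) (sphere 0 1 - K) (sphere 0 1 - K) id (\<lambda>_. - p)"
  proof (subst homotopic_with, simp, intro exI[of _ h] conjI ballI)
    show "continuous_map (prod_topology (top_of_set {0..1}) (top_of_set (sphere 0 1 - K)))
            (top_of_set (sphere 0 1 - K)) h"
      using conth him by (auto simp: image_subset_iff)
  qed (use p in \<open>auto simp: h_def v_def\<close>)
  then show ?thesis
    unfolding contractible_def by blast
qed

text \<open>The complements of \<open>P\<close> and \<open>Q\<close> form an open cover of the
  complement of \<open>P \<inter> Q\<close>, and they intersect in the complement of
  \<open>P \<union> Q\<close>.\<close>

lemma trivial_homology_group_sphere_minus_Un:
  fixes P Q :: "'a::euclidean_space set"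
  assumes "closed P" "closed Q"
    and "trivial_group (homology_group (p + 1) (top_of_set (sphere 0 1 - P \<inter> Q)))"
    and "trivial_group (homology_group p (top_of_set (sphere 0 1 - P)))"
    and "trivial_group (homology_group p (top_of_set (sphere 0 1 - Q)))"
  shows "trivial_group (homology_group p (top_of_set (sphere 0 1 - (P \<union> Q))))"
proof -
  let ?X = "sphere (0::'a) 1 - P \<inter> Q"
  have op: "openin (top_of_set ?X) (sphere 0 1 - R)" if "closed R" "P \<inter> Q \<subseteq> R" for R
  proof -
    have "sphere 0 1 - R = ?X \<inter> (- R)"
      using that by auto
    then show ?thesis
      using that by (metis openin_open_Int open_Compl)
  qed
  have sub: "subtopology (top_of_set ?X) (sphere 0 1 - R) = top_of_set (sphere 0 1 - R)"
    if "P \<inter> Q \<subseteq> R" for R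
  proof -
    have "?X \<inter> (sphere 0 1 - R) = sphere 0 1 - R"
      using that by auto
    then show ?thesis
      by (simp add: subtopology_subtopology)
  qed
  have "trivial_group (homology_group p (subtopology (top_of_set ?X) ((sphere 0 1 - P) \<inter> (sphere 0 1 - Q))))"
  proof (rule trivial_homology_group_intersection)
    show "openin (top_of_set ?X) (sphere 0 1 - P)" "openin (top_of_set ?X) (sphere 0 1 - Q)"
      using assms(1,2) by (auto intro!: op)
    show "(sphere 0 1 - P) \<union> (sphere 0 1 - Q) = topspace (top_of_set ?X)"
      by auto
  qed (use assms in \<open>simp_all add: sub\<close>)
  moreover have "(sphere (0::'a) 1 - P) \<inter> (sphere 0 1 - Q) = sphere 0 1 - (P \<union> Q)"
    by auto
  ultimately show ?thesis
    by (metis (no_types) sub Int_lower1 Un_upper1 subset_trans)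
qed

text \<open>
  In the induction step, the intersection of one cone with the union of the others is again a union
  of fewer cones; since its degree is \<open>q + 1\<close>, it is allowed to miss the sphere.
\<close>

lemma trivial_homology_group_sphere_minus_cones:
  fixes K :: "'i \<Rightarrow> 'a::euclidean_space set"
  assumes "finite I" "\<And>i. i \<in> I \<Longrightarrow> pointed_cone (K i)"
    and "2 \<le> DIM('a)" "int DIM('a) - 1 \<le> q"
    and "sphere 0 1 \<inter> (\<Union>i\<in>I. K i) \<noteq> {} \<or> int DIM('a) \<le> q"
  shows "trivial_group (homology_group q (top_of_set (sphere 0 1 - (\<Union>i\<in>I. K i))))"
  using assms
\<comment> \<open>Both vary because the hypothesis is also applied to the cones
  \<open>K i \<inter> K j\<close> in degree \<open>q + 1\<close>.\<close>
proof (induction I arbitrary: K q)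
  case empty
  \<comment> \<open>With no cones the last assumption forces \<open>int DIM('a) \<le> q\<close>,
    beyond the top degree of the sphere.\<close>
  then show ?case
    by (simp add: trivial_homology_group_sphere)
next
  case (insert i I)
  let ?S = "sphere (0::'a) 1"
  have "q \<noteq> 0"
    using insert.prems by linarith
  have Ki: "trivial_group (homology_group q (top_of_set (?S - K i)))" if meets: "?S \<inter> K i \<noteq> {}"
  proof -
    obtain p where "p \<in> ?S" "p \<in> K i"
      using meets by blast
    then have "contractible (?S - K i)"
      using insert.prems(1) by (intro contractible_sphere_minus_cone[of _ p]) auto
    then show ?thesis
      using \<open>q \<noteq> 0\<close> by (simp add: trivial_homology_group_contractible)
  qed
  have KI: "trivial_group (homology_group q (top_of_set (?S - (\<Union>j\<in>I. K j))))"
    if "?S \<inter> (\<Union>j\<in>I. K j) \<noteq> {} \<or> int DIM('a) \<le> q"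
    using insert.prems that by (intro insert.IH) auto
  \<comment> \<open>Cones that miss the sphere remove nothing from it, so only the third case needs
    Mayer-Vietoris.\<close>
  consider "?S \<inter> K i = {}" | "?S \<inter> (\<Union>j\<in>I. K j) = {}" "?S \<inter> K i \<noteq> {}"
    | "?S \<inter> (\<Union>j\<in>I. K j) \<noteq> {}" "?S \<inter> K i \<noteq> {}"
    by blast
  then show ?case
  proof cases
    case 1
    then have "?S - (\<Union>j\<in>insert i I. K j) = ?S - (\<Union>j\<in>I. K j)"
      by auto
    moreover have "?S \<inter> (\<Union>j\<in>I. K j) \<noteq> {} \<or> int DIM('a) \<le> q"
      using insert.prems(4) 1 by auto
    ultimately show ?thesis
      using KI by simp
  next
    case 2
    then have "?S - (\<Union>j\<in>insert i I. K j) = ?S - K i"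
      by auto
    then show ?thesis
      using Ki[OF 2(2)] by simp
  next
    case 3
    have "trivial_group (homology_group (q + 1) (top_of_set (?S - (\<Union>j\<in>I. K i \<inter> K j))))"
      using insert.prems by (intro insert.IH) (auto intro: pointed_cone_Int)
    then have "trivial_group (homology_group (q + 1) (top_of_set (?S - K i \<inter> (\<Union>j\<in>I. K j))))"
      by (simp only: Int_UN_distrib)
    moreover have "closed (K i)" "closed (\<Union>j\<in>I. K j)"
      using insert.hyps(1) insert.prems(1) by (auto simp: pointed_cone_def intro!: closed_UN)
    moreover have "trivial_group (homology_group q (top_of_set (?S - (\<Union>j\<in>I. K j))))"
      using 3(1) by (intro KI disjI1)
    ultimately have "trivial_group (homology_group q (top_of_set (?S - (K i \<union> (\<Union>j\<in>I. K j)))))"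
      using Ki[OF 3(2)] by (intro trivial_homology_group_sphere_minus_Un)
    then show ?thesis
      by simp
  qed
qed

text \<open>One degree below the range of the previous lemma, the overlap of a new cap with the old
  ones must meet the sphere; connectedness of \<open>C\<close> provides such a cap. As
  \<open>3 \<le> DIM('a)\<close>, the degree is positive, so contractible complements have trivial
  homology there.\<close>

lemma trivial_homology_group_sphere_minus_linked_caps:
  fixes C :: "'a::euclidean_space set"
  assumes dim: "3 \<le> DIM('a)" and t: "0 < t" "t < 1"
    and C: "connected C" "C \<subseteq> sphere 0 1"
    and T: "finite T" "T \<noteq> {}" "T \<subseteq> C" "C \<subseteq> (\<Union>c\<in>T. cap_cone t c)"
  shows "trivial_group (homology_group (int DIM('a) - 2) (top_of_set (sphere 0 1 - (\<Union>c\<in>T. cap_cone t c))))"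
proof -
  let ?S = "sphere (0::'a) 1" and ?q = "int DIM('a) - 2"
  \<comment> \<open>A maximal set of centres for which the claim holds must be all of \<open>T\<close>: otherwise
    connectedness of \<open>C\<close> supplies a further cap meeting the union.\<close>
  define good where "good = (\<lambda>V. V \<noteq> {} \<and> V \<subseteq> T \<and>
    trivial_group (homology_group ?q (top_of_set (?S - (\<Union>c\<in>V. cap_cone t c)))))"
  have centre: "c \<in> cap_cone t c" if "c \<in> T" for c
  proof -
    have "norm c = 1"
      using that T(3) C(2) by auto
    then show ?thesis
      using t by (simp add: cap_cone_def dot_square_norm)
  qed
  have cap: "trivial_group (homology_group ?q (top_of_set (?S - cap_cone t c)))" if "c \<in> T" for c
  proof -
    have "norm c = 1"
      using that T(3) C(2) by auto
    then have "contractible (?S - cap_cone t c)"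
      using contractible_sphere_minus_cone pointed_cone_cap_cone t(1) centre[OF that] by blast
    then show ?thesis
      using dim by (simp add: trivial_homology_group_contractible)
  qed
  obtain c0 where c0: "c0 \<in> T"
    using T(2) by blast
  have "{V. good V} \<subseteq> Pow T"
    by (auto simp: good_def)
  then have "finite {V. good V}"
    using T(1) finite_subset by auto
  moreover have "good {c0}"
    using c0 cap by (simp add: good_def)
  ultimately obtain V where V: "good V" and Vmax: "\<And>W. good W \<Longrightarrow> V \<subseteq> W \<Longrightarrow> W = V"
    using finite_has_maximal2[of "{V. good V}" "{c0}"] by auto
  have "V \<subseteq> T" "V \<noteq> {}" "finite V"
    using V T(1) by (auto simp: good_def intro: finite_subset)
  have "V = T"
  proof (rule ccontr)
    assume "V \<noteq> T"
    let ?A = "\<Union>c\<in>V. cap_cone t c" and ?B = "\<Union>c\<in>T - V. cap_cone t c"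
    have "closed ?A" "closed ?B"
      using T(1) \<open>finite V\<close> by (auto intro: closed_cap_cone)
    moreover have "C \<subseteq> ?A \<union> ?B"
      using T(4) by blast
    moreover have "?A \<inter> C \<noteq> {}"
      using \<open>V \<noteq> {}\<close> \<open>V \<subseteq> T\<close> centre T(3) by blast
    moreover have "?B \<inter> C \<noteq> {}"
      using \<open>V \<noteq> T\<close> \<open>V \<subseteq> T\<close> centre T(3) by blast
    \<comment> \<open>Two closed sets covering \<open>C\<close>, each containing a centre that lies
      in \<open>C\<close>, must meet inside \<open>C\<close>.\<close>
    ultimately have "?A \<inter> ?B \<inter> C \<noteq> {}"
      using connected_closedD[OF C(1)] by metis
    then obtain x c where x: "x \<in> ?A" "x \<in> C" and c: "c \<in> T" "c \<notin> V" "x \<in> cap_cone t c"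
      by blast
    \<comment> \<open>The point \<open>x\<close> shows that the overlap meets the sphere, as
      required in degree \<open>int DIM('a) - 1\<close>.\<close>
    have "trivial_group (homology_group (?q + 1) (top_of_set (?S - (\<Union>d\<in>V. cap_cone t c \<inter> cap_cone t d))))"
    proof (rule trivial_homology_group_sphere_minus_cones)
      have "x \<in> ?S \<inter> (\<Union>d\<in>V. cap_cone t c \<inter> cap_cone t d)"
        using x c C(2) by blast
      then show "?S \<inter> (\<Union>d\<in>V. cap_cone t c \<inter> cap_cone t d) \<noteq> {} \<or> int DIM('a) \<le> ?q + 1"
        by blast
    qed (use dim t \<open>finite V\<close> in \<open>auto intro: pointed_cone_Int pointed_cone_cap_cone\<close>)
    then have "trivial_group (homology_group (?q + 1) (top_of_set (?S - cap_cone t c \<inter> ?A)))"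
      by (simp only: Int_UN_distrib)
    moreover have "trivial_group (homology_group ?q (top_of_set (?S - ?A)))"
      using V unfolding good_def by (elim conjE)
    ultimately have "trivial_group (homology_group ?q (top_of_set (?S - (cap_cone t c \<union> ?A))))"
      by (rule trivial_homology_group_sphere_minus_Un[OF closed_cap_cone \<open>closed ?A\<close> _ cap[OF c(1)]])
    then have "good (insert c V)"
      using c(1) \<open>V \<subseteq> T\<close> by (simp only: good_def Union_insert image_insert insert_not_empty insert_subset) simp
    then show False
      using Vmax[of "insert c V"] c by blast
  qed
  then show ?thesis
    using V by (simp add: good_def)
qed

section \<open>From finitely many caps to compact sets\<close>

lemma cap_cone_cover:
  fixes C L :: "'a::euclidean_space set"
  assumes C: "compact C" "C \<noteq> {}" "C \<subseteq> sphere 0 1"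
    and L: "compact L" "L \<subseteq> sphere 0 1" "C \<inter> L = {}"
  obtains t T where "0 < t" "t < 1" "finite T" "T \<noteq> {}" "T \<subseteq> C"
    "C \<subseteq> (\<Union>c\<in>T. cap_cone t c)" "L \<inter> (\<Union>c\<in>T. cap_cone t c) = {}"
proof -
  obtain e where e: "e > 0" "\<And>x y. x \<in> C \<Longrightarrow> y \<in> L \<Longrightarrow> e \<le> dist x y"
    using separate_compact_closed[OF C(1) compact_imp_closed[OF L(1)] L(3)] by auto
  \<comment> \<open>For unit vectors the squared distance is \<open>2 - 2 * (x \<bullet> c)\<close>,
    so the second entry bounds it by \<open>e\<^sup>2 / 2\<close> on a cap; the first keeps
    \<open>t\<close> positive for large \<open>e\<close>.\<close>
  define t where "t = max (1/2) (1 - e\<^sup>2 / 4)"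
  have t: "0 < t" "t < 1"
    using e(1) by (auto simp: t_def)
  \<comment> \<open>Strict inequalities give open sets, hence a finite subcover; on the sphere the
    closed caps contain them.\<close>
  have "C \<subseteq> (\<Union>c\<in>C. {x. t < x \<bullet> c})"
  proof
    fix x assume "x \<in> C"
    moreover from this have "x \<bullet> x = 1"
      using C(3) by (auto simp: dot_square_norm)
    ultimately show "x \<in> (\<Union>c\<in>C. {x. t < x \<bullet> c})"
      using t(2) by (intro UN_I[of x]) auto
  qed
  moreover have "open {x. t < x \<bullet> c}" for c :: 'a
    by (intro open_Collect_less continuous_intros)
  ultimately obtain T where T: "T \<subseteq> C" "finite T" "C \<subseteq> (\<Union>c\<in>T. {x. t < x \<bullet> c})"
    using compactE_image[OF C(1), of C "\<lambda>c. {x. t < x \<bullet> c}"] by metis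
  have "C \<subseteq> (\<Union>c\<in>T. cap_cone t c)"
  proof
    fix x assume x: "x \<in> C"
    then obtain c where "c \<in> T" "t < x \<bullet> c"
      using T(3) by blast
    moreover have "norm x = 1"
      using x C(3) by auto
    ultimately show "x \<in> (\<Union>c\<in>T. cap_cone t c)"
      by (intro UN_I[of c]) (auto simp: cap_cone_def)
  qed
  moreover have "x \<notin> cap_cone t c" if "x \<in> L" "c \<in> T" for x c
  proof
    assume "x \<in> cap_cone t c"
    moreover have n: "norm x = 1" "norm c = 1"
      using that T(1) C(3) L(2) by auto
    ultimately have "t \<le> x \<bullet> c"
      by (simp add: cap_cone_def)
    have "e\<^sup>2 \<le> (dist c x)\<^sup>2"
      using e that T(1) by (intro power_mono) auto
    also have "\<dots> = 2 - 2 * (x \<bullet> c)"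
      using n by (simp add: dist_norm power2_norm_eq_inner inner_diff inner_commute)
                 (simp add: dot_square_norm)
    also have "\<dots> \<le> e\<^sup>2 / 2"
      using \<open>t \<le> x \<bullet> c\<close> by (simp add: t_def)
    finally show False
      using e(1) by simp
  qed
  ultimately show ?thesis
    using that[of t T] t T C(2) by blast
qed

text \<open>Alexander duality in the top degree of the sphere: caps covering the nonempty set
  \<open>C\<close> meet the sphere, as the lemma on cones asks in this degree.\<close>

proposition trivial_homology_group_sphere_minus_compact:
  fixes C :: "'a::euclidean_space set"
  assumes C: "compact C" "C \<noteq> {}" "C \<subseteq> sphere 0 1" and dim: "2 \<le> DIM('a)"
  shows "trivial_group (homology_group (int (DIM('a) - 1)) (top_of_set (sphere 0 1 - C)))"
proof (rule trivial_homology_group_compact_exhaustion)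
  fix L :: "'a set" assume L: "compact L" "L \<subseteq> sphere 0 1 - C"
  obtain t T where T: "0 < t" "t < 1" "finite T" "T \<noteq> {}" "T \<subseteq> C"
    "C \<subseteq> (\<Union>c\<in>T. cap_cone t c)" "L \<inter> (\<Union>c\<in>T. cap_cone t c) = {}"
    using cap_cone_cover[OF C L(1)] L(2) by blast
  have "trivial_group (homology_group (int (DIM('a) - 1)) (top_of_set (sphere 0 1 - (\<Union>c\<in>T. cap_cone t c))))"
  proof (rule trivial_homology_group_sphere_minus_cones)
    have "C \<subseteq> sphere 0 1 \<inter> (\<Union>c\<in>T. cap_cone t c)"
      using T C by blast
    then show "sphere 0 1 \<inter> (\<Union>c\<in>T. cap_cone t c) \<noteq> {} \<or> int DIM('a) \<le> int (DIM('a) - 1)"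
      using C(2) by blast
  qed (use T dim in \<open>auto intro: pointed_cone_cap_cone\<close>)
  then show "\<exists>V. L \<subseteq> V \<and> V \<subseteq> sphere 0 1 - C \<and>
      trivial_group (homology_group (int (DIM('a) - 1)) (top_of_set V))"
    using T L(2) by (intro exI[of _ "sphere 0 1 - (\<Union>c\<in>T. cap_cone t c)"]) blast
qed

text \<open>Alexander duality one degree lower, where connectedness of \<open>C\<close> means
  vanishing reduced Cech cohomology in degree zero.\<close>

proposition trivial_homology_group_sphere_minus_connected:
  fixes C :: "'a::euclidean_space set"
  assumes C: "compact C" "C \<noteq> {}" "C \<subseteq> sphere 0 1" "connected C" and dim: "3 \<le> DIM('a)"
  shows "trivial_group (homology_group (int (DIM('a) - 2)) (top_of_set (sphere 0 1 - C)))"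
proof (rule trivial_homology_group_compact_exhaustion)
  fix L :: "'a set" assume L: "compact L" "L \<subseteq> sphere 0 1 - C"
  obtain t T where T: "0 < t" "t < 1" "finite T" "T \<noteq> {}" "T \<subseteq> C"
    "C \<subseteq> (\<Union>c\<in>T. cap_cone t c)" "L \<inter> (\<Union>c\<in>T. cap_cone t c) = {}"
    using cap_cone_cover[OF C(1-3) L(1)] L(2) by blast
  have "int (DIM('a) - 2) = int DIM('a) - 2"
    using dim by simp
  then have "trivial_group (homology_group (int (DIM('a) - 2)) (top_of_set (sphere 0 1 - (\<Union>c\<in>T. cap_cone t c))))"
    using trivial_homology_group_sphere_minus_linked_caps[OF dim T(1,2) C(4,3) T(3-6)] by metis
  then show "\<exists>V. L \<subseteq> V \<and> V \<subseteq> sphere 0 1 - C \<and>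
      trivial_group (homology_group (int (DIM('a) - 2)) (top_of_set V))"
    using T L(2) by (intro exI[of _ "sphere 0 1 - (\<Union>c\<in>T. cap_cone t c)"]) blast
qed

subsection \<open>Preimages of balls\<close>

text \<open>If the complement split into two closed parts, the connected image of \<open>Z\<close>
  would lie in one of them, and the other could be split off from the whole sphere.\<close>

lemma connected_sphere_minus_image:
  fixes h :: "'b::euclidean_space \<Rightarrow> 'a::euclidean_space"
  assumes h: "continuous_on UNIV h" "inj h" "range h \<subseteq> sphere 0 1"
    and U: "bounded U"
    and Z: "connected Z" "closure U - U \<subseteq> Z" "Z \<inter> U = {}"
    and ne: "U \<noteq> {}" and C: "closed (sphere 0 1 - h ` U)" and dim: "2 \<le> DIM('a)"
  shows "connected (sphere 0 1 - h ` U)"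
proof -
  let ?S = "sphere (0::'a) 1"
  let ?C = "?S - h ` U"
  have hZ: "connected (h ` Z)" "h ` Z \<subseteq> ?C"
    using Z(1,3) h by (auto intro: connected_continuous_image continuous_on_subset dest: injD)
  have "compact (closure U)"
    using U by (simp add: compact_closure)
  then have hcl: "closed (h ` closure U)"
    using h(1) by (meson compact_continuous_image compact_imp_closed continuous_on_subset subset_UNIV)
  have sub: "h ` closure U \<subseteq> h ` U \<union> h ` Z"
    using Z(2) by blast
  \<comment> \<open>A relatively clopen part of the complement that misses \<open>h ` Z\<close> is clopen in the whole sphere.\<close>
  have *: "A \<inter> ?C = {}"
    if "closed A" "closed B" "?C \<subseteq> A \<union> B" "A \<inter> B \<inter> ?C = {}" "A \<inter> h ` Z = {}" for A B
  proof -
    \<comment> \<open>Taking the closure of \<open>U\<close> makes this set closed; the points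
      gained lie in the image of \<open>Z\<close>, which \<open>A\<close> misses.\<close>
    let ?W = "(B \<inter> ?C) \<union> h ` closure U"
    have "connected ?S"
      using dim by (rule connected_sphere)
    moreover have "closed (A \<inter> ?C)" "closed ?W"
      using C hcl that by auto
    moreover have "?S \<subseteq> (A \<inter> ?C) \<union> ?W"
      using that(3) closure_subset[of U] by blast
    moreover have "(A \<inter> ?C) \<inter> ?W \<inter> ?S = {}"
      using that(4,5) sub by fast
    ultimately have "(A \<inter> ?C) \<inter> ?S = {} \<or> ?W \<inter> ?S = {}"
      using connected_closedD by metis
    moreover have "?W \<inter> ?S \<noteq> {}"
      using ne closure_subset[of U] h(3) by blast
    ultimately show ?thesis
      by blast
  qed
  show ?thesis
    unfolding connected_closed
  proof (intro notI, elim exE conjE)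
    fix A B assume AB: "closed A" "closed B" "?C \<subseteq> A \<union> B" "A \<inter> B \<inter> ?C = {}"
      "A \<inter> ?C \<noteq> {}" "B \<inter> ?C \<noteq> {}"
    have "A \<inter> h ` Z = {} \<or> B \<inter> h ` Z = {}"
      using AB hZ by (intro connected_closedD) auto
    then show False
      using *[of A B] *[of B A] AB by (auto simp: Un_commute Int_commute)
  qed
qed

text \<open>A homeomorphism onto a punctured sphere turns \<open>U\<close> into the complement of a
  compact set. The ambient dimension grows by one, which matches the degrees of the two propositions
  on complements.\<close>

lemma trivial_homology_groups_connected_boundary:
  fixes U Z :: "'b::euclidean_space set"
  assumes U: "open U" "bounded U" "U \<noteq> {}"
    and Z: "connected Z" "closure U - U \<subseteq> Z" "Z \<inter> U = {}"
    and dim: "2 \<le> DIM('b)"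
  shows "trivial_group (homology_group (int (DIM('b) - 1)) (top_of_set U))"
    and "trivial_group (homology_group (int DIM('b)) (top_of_set U))"
proof -
  let ?S = "sphere (0 :: 'b \<times> real) 1"
  define b where "b = (0 :: 'b, 1 :: real)"
  have "?S - {b} homeomorphic (UNIV :: 'b set)"
    by (rule homeomorphic_punctured_sphere_affine) (auto simp: b_def)
  then obtain g h where gh: "homeomorphism (?S - {b}) (UNIV :: 'b set) g h"
    unfolding homeomorphic_def by blast
  then have hg: "homeomorphism (UNIV :: 'b set) (?S - {b}) h g"
    by (rule homeomorphism_symD)
  have h: "continuous_on UNIV h" "inj h" "range h = ?S - {b}"
    using hg by (auto simp: homeomorphism_def intro: inj_on_inverseI)
  have "openin (top_of_set (?S - {b})) (h ` U)"
    using homeomorphism_imp_open_map[OF hg, of U] U(1) by simp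
  moreover have "openin (top_of_set ?S) (?S - {b})"
    by (simp add: openin_delete)
  ultimately have "openin (top_of_set ?S) (h ` U)"
    by (rule openin_trans)
  then have "closedin (top_of_set ?S) (?S - h ` U)"
    by (simp add: closedin_diff)
  then have C: "closed (?S - h ` U)" "compact (?S - h ` U)"
    by (metis closed_sphere closedin_closed_eq, metis closedin_compact compact_sphere)
  have conn: "connected (?S - h ` U)"
    by (rule connected_sphere_minus_image[OF h(1,2) _ U(2) Z U(3) C(1)]) (use h(3) dim in auto)
  \<comment> \<open>The puncture keeps the removed compact set nonempty.\<close>
  have "b \<in> ?S - h ` U"
    using h(3) by (auto simp: b_def)
  then have ne: "?S - h ` U \<noteq> {}"
    by blast
  have hU: "?S - (?S - h ` U) = h ` U"
    using h(3) by auto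
  have "homeomorphism U (h ` U) h g"
    by (rule homeomorphism_of_subsets[OF hg _ subset_refl]) auto
  then have "top_of_set U homeomorphic_space top_of_set (h ` U)"
    by (metis homeomorphic_def homeomorphic_space_iff_homeomorphic)
  then have iso: "trivial_group (homology_group p (top_of_set U)) \<longleftrightarrow>
      trivial_group (homology_group p (top_of_set (h ` U)))" for p
    by (intro isomorphic_group_triviality homeomorphic_space_imp_isomorphic_homology_groups
        group_relative_homology_group)
  have dims: "DIM('b \<times> real) - 2 = DIM('b) - 1" "DIM('b \<times> real) - 1 = DIM('b)"
    using dim by simp_all
  have dim2: "2 \<le> DIM('b \<times> real)" and dim3: "3 \<le> DIM('b \<times> real)"
    using dim by simp_all
  show "trivial_group (homology_group (int (DIM('b) - 1)) (top_of_set U))"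
    using trivial_homology_group_sphere_minus_connected[OF C(2) ne Diff_subset conn dim3]
    unfolding iso hU dims .
  show "trivial_group (homology_group (int DIM('b)) (top_of_set U))"
    using trivial_homology_group_sphere_minus_compact[OF C(2) ne Diff_subset dim2]
    unfolding iso hU dims .
qed

text \<open>Properness makes \<open>f\<close> a closed map, and closed surjections with connected
  fibres pull connected sets back to connected sets. This applies to the ball and to its boundary
  sphere, connected as \<open>2 \<le> DIM('b)\<close>.\<close>

lemma monotone_proper_preimage_ball:
  fixes f :: "'a::euclidean_space \<Rightarrow> 'b::euclidean_space"
  assumes dim: "2 \<le> DIM('b)" and \<Omega>: "open \<Omega>" and cont: "continuous_on \<Omega> f" and surj: "f ` \<Omega> = \<Omega>'"
    and mono: "monotone_map (top_of_set \<Omega>) (top_of_set \<Omega>') f"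
    and proper: "\<And>K. K \<subseteq> \<Omega>' \<Longrightarrow> compact K \<Longrightarrow> compact (\<Omega> \<inter> f -` K)"
    and r: "r > 0" "cball y r \<subseteq> \<Omega>'"
  defines "U \<equiv> \<Omega> \<inter> f -` ball y r" and "Z \<equiv> \<Omega> \<inter> f -` sphere y r"
  shows "open U" "bounded U" "U \<noteq> {}" "connected U" "connected Z" "closure U - U \<subseteq> Z" "Z \<inter> U = {}"
proof -
  have "closedin (top_of_set \<Omega>') (f ` K)" if "closedin (top_of_set \<Omega>) K" for K
    by (rule proper_map[OF that proper]) (use surj in auto)
  moreover have "connected (\<Omega> \<inter> f -` {z})" if "z \<in> \<Omega>'" for z
  proof -
    have "connectedin (top_of_set \<Omega>) {x \<in> \<Omega>. f x = z}"
      using mono that by (simp add: monotone_map_def)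
    moreover have "{x \<in> \<Omega>. f x = z} = \<Omega> \<inter> f -` {z}"
      by auto
    ultimately show ?thesis
      by (simp add: connectedin_subtopology)
  qed
  ultimately have pre: "connected (\<Omega> \<inter> f -` A)" if "connected A" "A \<subseteq> \<Omega>'" for A
    using connected_closed_monotone_preimage[OF cont surj _ _ that] by blast
  have sub: "ball y r \<subseteq> \<Omega>'" "sphere y r \<subseteq> \<Omega>'"
    using r(2) by (auto simp: subset_iff)
  show "connected U"
    unfolding U_def using sub by (intro pre) auto
  show "connected Z"
    unfolding Z_def using sub connected_sphere[OF dim] by (intro pre) auto
  show "open U"
    unfolding U_def using \<Omega> cont by (intro continuous_open_preimage) auto
  have K: "compact (\<Omega> \<inter> f -` cball y r)"
    using r(2) by (intro proper) auto
  have UK: "U \<subseteq> \<Omega> \<inter> f -` cball y r"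
    by (auto simp: U_def)
  then show "bounded U"
    using K compact_imp_bounded bounded_subset by blast
  \<comment> \<open>The closure is taken in the whole space; compactness of the preimage keeps it
    inside \<open>\<Omega>\<close>.\<close>
  have "closure U \<subseteq> \<Omega> \<inter> f -` cball y r"
    using UK by (rule closure_minimal) (rule compact_imp_closed[OF K])
  then show "closure U - U \<subseteq> Z"
    by (auto simp: U_def Z_def subset_iff)
  show "U \<noteq> {}"
    using surj sub(1) r(1) centre_in_ball[of y r] unfolding U_def by blast
  show "Z \<inter> U = {}"
    by (auto simp: U_def Z_def)
qed

subsection \<open>Real coefficients\<close>

lemma common_denominator:
  fixes F :: "rat set"
  assumes "finite F"
  shows "\<exists>N>0. \<forall>q\<in>F. of_int N * q \<in> \<int>"
  using assms
proof induction
  case empty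
  show ?case
    by (intro exI[of _ 1]) simp
next
  case (insert q F)
  then obtain N where N: "N > 0" "\<forall>q\<in>F. of_int N * q \<in> \<int>"
    by blast
  obtain a b where ab: "q = of_int a / of_int b" "b > 0"
    by (cases q) (auto simp: Fract_of_int_quotient)
  have "of_int (N * b) * q = of_int (N * a)"
    using ab by simp
  moreover have "of_int (N * b) * x = of_int b * (of_int N * x)" for x :: rat
    by simp
  ultimately have "\<forall>x\<in>insert q F. of_int (N * b) * x \<in> \<int>"
    using N(2) by (metis Ints_mult Ints_of_int insert_iff)
  then show ?case
    using N(1) ab(2) by (intro exI[of _ "N * b"]) simp
qed

text \<open>Finitely generated subgroups of the reals are free: integer relations pass to the coordinates.\<close>

lemma integer_decomposition:
  fixes c :: "'s \<Rightarrow> real"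
  assumes S: "finite S"
  obtains B :: "real set" and w :: "real \<Rightarrow> real" and m :: "real \<Rightarrow> 's \<Rightarrow> int"
  where "finite B" "\<And>s. s \<in> S \<Longrightarrow> c s = (\<Sum>b\<in>B. w b * of_int (m b s))"
    "\<And>u b. (\<Sum>s\<in>S. of_int (u s) * c s) = 0 \<Longrightarrow> b \<in> B \<Longrightarrow> (\<Sum>s\<in>S. u s * m b s) = 0"
proof -
  interpret Q: vector_space "\<lambda>(q::rat) (x::real). of_rat q * x"
    by unfold_locales (simp_all add: algebra_simps of_rat_add of_rat_mult)
  obtain B where B: "B \<subseteq> c ` S" "Q.independent B" "c ` S \<subseteq> Q.span B"
    by (rule Q.maximal_independent_subset)
  have fin: "finite B"
    using B(1) S finite_subset by blast
  have span: "c s \<in> Q.span B" if "s \<in> S" for s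
    using B(3) that by blast
  define \<rho> where "\<rho> = (\<lambda>s. Q.representation B (c s))"
  have rep: "c s = (\<Sum>b\<in>B. of_rat (\<rho> s b) * b)" if "s \<in> S" for s
    using Q.sum_representation_eq[OF B(2) span[OF that] fin subset_refl] by (simp add: \<rho>_def)
  have "finite ((\<lambda>(s, b). \<rho> s b) ` (S \<times> B))"
    using S fin by simp
  then obtain N where N: "N > 0" "\<forall>q\<in>(\<lambda>(s, b). \<rho> s b) ` (S \<times> B). of_int N * q \<in> \<int>"
    using common_denominator by meson
  \<comment> \<open>On \<open>S\<close> and \<open>B\<close> the scaled coordinates are already
    integers, so the floor only changes the type.\<close>
  define m where "m = (\<lambda>b s. \<lfloor>of_int N * \<rho> s b\<rfloor>)"
  have m: "of_int (m b s) = of_int N * \<rho> s b" if "s \<in> S" "b \<in> B" for s b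
    using N(2) that by (auto simp: m_def elim!: Ints_cases)
  \<comment> \<open>The common denominator is absorbed into the weights.\<close>
  have 1: "c s = (\<Sum>b\<in>B. b / of_int N * of_int (m b s))" if s: "s \<in> S" for s
  proof -
    have "of_rat (\<rho> s b) * b = b / of_int N * of_int (m b s)" if "b \<in> B" for b
    proof -
      have "(of_int (m b s) :: real) = of_int N * of_rat (\<rho> s b)"
        using arg_cong[OF m[OF s that], of "of_rat :: rat \<Rightarrow> real"] by (simp add: of_rat_mult)
      then show ?thesis
        using N(1) by simp
    qed
    then show ?thesis
      using rep[OF s] by simp
  qed
  have 2: "(\<Sum>s\<in>S. u s * m b s) = 0"
    if u: "(\<Sum>s\<in>S. of_int (u s) * c s) = 0" and b: "b \<in> B" for u :: "'s \<Rightarrow> int" and b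
  proof -
    \<comment> \<open>Coordinates along \<open>B\<close> are linear over the rationals, so an
      integer relation holds in each of them.\<close>
    have "0 = Q.representation B (\<Sum>s\<in>S. of_rat (of_int (u s)) * c s) b"
      using u by (simp add: Q.representation_zero)
    also have "\<dots> = (\<Sum>s\<in>S. Q.representation B (of_rat (of_int (u s)) * c s) b)"
      by (rule fun_cong[OF Q.representation_sum[OF B(2) Q.span_scale[OF span]]])
    also have "\<dots> = (\<Sum>s\<in>S. of_int (u s) * \<rho> s b)"
      unfolding \<rho>_def using B(2) span by (intro sum.cong refl) (subst Q.representation_scale, auto)
    finally have "of_int N * (\<Sum>s\<in>S. of_int (u s) * \<rho> s b) = 0"
      by simp
    moreover have "(\<Sum>s\<in>S. of_int (u s) * of_int (m b s)) = of_int N * (\<Sum>s\<in>S. of_int (u s) * \<rho> s b)"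
      unfolding sum_distrib_left using m b by (intro sum.cong refl) simp
    ultimately have "(of_int (\<Sum>s\<in>S. u s * m b s) :: rat) = 0"
      by simp
    then show ?thesis
      by (simp only: of_int_eq_0_iff)
  qed
  show thesis
    by (rule that[of B "\<lambda>b. b / of_int N" m]) (fact fin 1 2)+
qed

section \<open>Integral and real chains compared\<close>

text \<open>The matrix of the boundary operator in positive degree, the same for both kinds of
  chains. Being integral, it makes the cycle condition a system of integer relations.\<close>

definition face_coeff :: "nat \<Rightarrow> ((nat \<Rightarrow> real) \<Rightarrow> 'a) \<Rightarrow> ((nat \<Rightarrow> real) \<Rightarrow> 'a) \<Rightarrow> int" where
  "face_coeff p t s = (\<Sum>k\<le>p. if singular_face p k s = t then (-1) ^ k else 0)"

text \<open>The superset \<open>A\<close> lets chains with different supports be summed over one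
  index set.\<close>

lemma lookup_real_chain_boundary:
  assumes "p > 0" "finite A" "Poly_Mapping.keys c \<subseteq> A"
  shows "Poly_Mapping.lookup (real_chain_boundary p c) t =
    (\<Sum>s\<in>A. of_int (face_coeff p t s) * Poly_Mapping.lookup c s)"
proof -
  have "Poly_Mapping.lookup (real_chain_boundary p c) t =
      (\<Sum>s\<in>Poly_Mapping.keys c. \<Sum>k\<le>p. (-1) ^ k * Poly_Mapping.lookup c s when singular_face p k s = t)"
    using assms(1) by (simp add: real_chain_boundary_def lookup_sum lookup_single)
  also have "\<dots> = (\<Sum>s\<in>Poly_Mapping.keys c. of_int (face_coeff p t s) * Poly_Mapping.lookup c s)"
    by (intro sum.cong refl)
       (simp add: face_coeff_def sum_distrib_right, intro sum.cong refl, simp add: when_def)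
  also have "\<dots> = (\<Sum>s\<in>A. of_int (face_coeff p t s) * Poly_Mapping.lookup c s)"
    using assms(2,3) by (intro sum.mono_neutral_left) (auto simp: in_keys_iff)
  finally show ?thesis .
qed

lemma lookup_chain_boundary:
  assumes "p > 0" "finite A" "Poly_Mapping.keys c \<subseteq> A"
  shows "Poly_Mapping.lookup (chain_boundary p c) t =
    (\<Sum>s\<in>A. face_coeff p t s * Poly_Mapping.lookup c s)"
proof -
  have "Poly_Mapping.lookup (chain_boundary p c) t =
      (\<Sum>s\<in>Poly_Mapping.keys c. Poly_Mapping.lookup c s *
         (\<Sum>k\<le>p. (-1) ^ k * (if t = singular_face p k s then 1 else 0)))"
    using assms(1) by (simp add: chain_boundary_def frag_extend_def lookup_sum lookup_single)
  also have "\<dots> = (\<Sum>s\<in>Poly_Mapping.keys c. face_coeff p t s * Poly_Mapping.lookup c s)"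
    by (intro sum.cong refl)
       (simp add: face_coeff_def sum_distrib_right sum_distrib_left, intro sum.cong refl, auto)
  also have "\<dots> = (\<Sum>s\<in>A. face_coeff p t s * Poly_Mapping.lookup c s)"
    using assms(2,3) by (intro sum.mono_neutral_left) (auto simp: in_keys_iff)
  finally show ?thesis .
qed

lemma lookup_map_mult:
  "Poly_Mapping.lookup (Poly_Mapping.map ((*) (r::real)) c) s = r * Poly_Mapping.lookup c s"
  by (simp add: Poly_Mapping.map.rep_eq when_def)

lemma keys_map_mult: "Poly_Mapping.keys (Poly_Mapping.map ((*) (r::real)) c) \<subseteq> Poly_Mapping.keys c"
  by (auto simp: in_keys_iff lookup_map_mult)

lemma real_chain_boundary_zero [simp]: "real_chain_boundary p 0 = 0"
  by (simp add: real_chain_boundary_def)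

lemma real_chain_boundary_add:
  "real_chain_boundary p (c + d) = real_chain_boundary p c + real_chain_boundary p d"
proof (cases "p = 0")
  case False
  let ?A = "Poly_Mapping.keys c \<union> Poly_Mapping.keys d"
  show ?thesis
    using False
    by (intro poly_mapping_eqI)
       (simp add: lookup_add keys_add lookup_real_chain_boundary[where A = ?A] sum.distrib distrib_left)
qed (simp add: real_chain_boundary_def)

lemma real_chain_boundary_map_mult:
  "real_chain_boundary p (Poly_Mapping.map ((*) r) c) = Poly_Mapping.map ((*) r) (real_chain_boundary p c)"
proof (cases "p = 0")
  case False
  then show ?thesis
    by (intro poly_mapping_eqI)
       (simp add: lookup_map_mult keys_map_mult lookup_real_chain_boundary[where A = "Poly_Mapping.keys c"]
         sum_distrib_left mult_ac)
qed (simp add: real_chain_boundary_def poly_mapping_eqI lookup_map_mult)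

lemma real_chain_boundary_sum:
  "real_chain_boundary p (\<Sum>i\<in>I. c i) = (\<Sum>i\<in>I. real_chain_boundary p (c i))"
  by (induction I rule: infinite_finite_induct) (simp_all add: real_chain_boundary_add)

text \<open>The integral chain tensored with \<open>b\<close>; sums of these carry integral results
  over to real chains.\<close>

definition real_multiple :: "real \<Rightarrow> 'a chain \<Rightarrow> 'a real_chain" where
  "real_multiple b = Poly_Mapping.map (\<lambda>m. b * of_int m)"

lemma lookup_real_multiple: "Poly_Mapping.lookup (real_multiple b d) s = b * of_int (Poly_Mapping.lookup d s)"
  by (simp add: real_multiple_def Poly_Mapping.map.rep_eq when_def)

lemma real_multiple_zero [simp]: "real_multiple b 0 = 0"
  by (intro poly_mapping_eqI) (simp add: lookup_real_multiple)

lemma keys_real_multiple: "Poly_Mapping.keys (real_multiple b d) \<subseteq> Poly_Mapping.keys d"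
  by (auto simp: in_keys_iff lookup_real_multiple)

lemma real_chain_boundary_real_multiple:
  "real_chain_boundary p (real_multiple b d) = real_multiple b (chain_boundary p d)"
proof (cases "p = 0")
  case True
  then show ?thesis
    by (simp add: real_chain_boundary_def chain_boundary_def real_multiple_def poly_mapping_eqI
        Poly_Mapping.map.rep_eq)
next
  case False
  then show ?thesis
    by (intro poly_mapping_eqI)
       (simp add: lookup_real_multiple keys_real_multiple lookup_real_chain_boundary[where A = "Poly_Mapping.keys d"]
         lookup_chain_boundary[where A = "Poly_Mapping.keys d"] sum_distrib_left mult_ac)
qed


lemma carrier_real_chain_space_sum_multiple:
  assumes "\<And>i. i \<in> I \<Longrightarrow> singular_chain p X (c i)"
  shows "(\<Sum>i\<in>I. real_multiple (w i) (c i)) \<in> carrier (real_chain_space p X)"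
proof -
  have "Poly_Mapping.keys (real_multiple (w i) (c i)) \<subseteq> singular_simplex_set p X" if "i \<in> I" for i
    using keys_real_multiple[of "w i" "c i"] assms[OF that] by (auto simp: singular_chain_def)
  then have "(\<Union>i\<in>I. Poly_Mapping.keys (real_multiple (w i) (c i))) \<subseteq> singular_simplex_set p X"
    by (rule UN_least)
  then show ?thesis
    using keys_sum[of "\<lambda>i. real_multiple (w i) (c i)" I] by (simp add: real_chain_space_def)
qed

lemma real_chain_expansion:
  "c = (\<Sum>s\<in>Poly_Mapping.keys c. real_multiple (Poly_Mapping.lookup c s) (frag_of s))"
proof (rule poly_mapping_eqI)
  fix t
  have "Poly_Mapping.lookup (\<Sum>s\<in>Poly_Mapping.keys c. real_multiple (Poly_Mapping.lookup c s) (frag_of s)) t =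
      (\<Sum>s\<in>Poly_Mapping.keys c. if t = s then Poly_Mapping.lookup c s else 0)"
    unfolding lookup_sum by (intro sum.cong refl) (simp add: lookup_real_multiple lookup_single when_def)
  then show "Poly_Mapping.lookup c t =
      Poly_Mapping.lookup (\<Sum>s\<in>Poly_Mapping.keys c. real_multiple (Poly_Mapping.lookup c s) (frag_of s)) t"
    by (simp add: in_keys_iff)
qed

text \<open>Expanding over single simplices reduces this to the integral fact that a boundary has
  zero boundary.\<close>

lemma real_boundaries_subset: "real_boundaries p X \<subseteq> carrier (real_cycle_space p X)"
proof
  fix c assume "c \<in> real_boundaries p X"
  then obtain d where d: "Poly_Mapping.keys d \<subseteq> singular_simplex_set (Suc p) X"
      and c: "c = real_chain_boundary (Suc p) d"
    by (auto simp: real_boundaries_def real_chain_space_def)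
  let ?D = "Poly_Mapping.keys d"
  have s: "singular_chain (Suc p) X (frag_of s)" if "s \<in> ?D" for s
    using d that by (auto simp: singular_chain_of)
  have "c = real_chain_boundary (Suc p)
      (\<Sum>s\<in>?D. real_multiple (Poly_Mapping.lookup d s) (frag_of s))"
    unfolding c using arg_cong[OF real_chain_expansion[of d]] .
  then have c': "c = (\<Sum>s\<in>?D. real_multiple (Poly_Mapping.lookup d s) (chain_boundary (Suc p) (frag_of s)))"
    by (simp only: real_chain_boundary_sum real_chain_boundary_real_multiple)
  have "c \<in> carrier (real_chain_space p X)"
    unfolding c' by (rule carrier_real_chain_space_sum_multiple) (use s singular_chain_boundary in fastforce)
  moreover have "real_chain_boundary p c =
      (\<Sum>s\<in>?D. real_multiple (Poly_Mapping.lookup d s) (chain_boundary p (chain_boundary (Suc p) (frag_of s))))"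
    unfolding c' by (simp only: real_chain_boundary_sum real_chain_boundary_real_multiple)
  then have "real_chain_boundary p c = 0"
    using chain_boundary_boundary[OF s] by simp
  ultimately show "c \<in> carrier (real_cycle_space p X)"
    by (simp add: real_cycle_space_def)
qed

text \<open>The cycle condition is one integer relation per face \<open>t\<close> among the
  coefficients, so it passes to their integer coordinates. Each chain of coordinates is then an
  integral cycle and bounds, and the fillings recombine with the weights \<open>w\<close>.\<close>

lemma real_cycle_in_real_boundaries:
  assumes q: "p > 0" and X: "trivial_group (homology_group (int p) X)"
    and c: "c \<in> carrier (real_cycle_space p X)"
  shows "c \<in> real_boundaries p X"
proof -
  let ?S = "Poly_Mapping.keys c"
  have S: "?S \<subseteq> singular_simplex_set p X" and bc: "real_chain_boundary p c = 0"
    using c by (auto simp: real_cycle_space_def real_chain_space_def)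
  obtain B :: "real set" and w :: "real \<Rightarrow> real" and m where B: "finite B"
    and cw: "\<And>s. s \<in> ?S \<Longrightarrow> Poly_Mapping.lookup c s = (\<Sum>b\<in>B. w b * of_int (m b s))"
    and m: "\<And>u b. (\<Sum>s\<in>?S. of_int (u s) * Poly_Mapping.lookup c s) = 0 \<Longrightarrow> b \<in> B \<Longrightarrow>
      (\<Sum>s\<in>?S. u s * m b s) = 0"
  proof (rule integer_decomposition[OF finite_keys, of c "Poly_Mapping.lookup c"])
    fix B :: "real set" and w :: "real \<Rightarrow> real" and m :: "real \<Rightarrow> _ \<Rightarrow> int"
    assume *: "finite B"
      "\<And>s. s \<in> ?S \<Longrightarrow> Poly_Mapping.lookup c s = (\<Sum>b\<in>B. w b * of_int (m b s))"
      "\<And>u b. (\<Sum>s\<in>?S. of_int (u s) * Poly_Mapping.lookup c s) = 0 \<Longrightarrow> b \<in> B \<Longrightarrow>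
        (\<Sum>s\<in>?S. u s * m b s) = 0"
    show thesis
      by (rule that[of B w m]) (fact *)+
  qed
  define z where "z = (\<lambda>b. \<Sum>s\<in>?S. Poly_Mapping.single s (m b s))"
  have lz: "Poly_Mapping.lookup (z b) s = (if s \<in> ?S then m b s else 0)" for b s
    by (simp add: z_def lookup_sum lookup_single when_def)
  have kz: "Poly_Mapping.keys (z b) \<subseteq> ?S" for b
    by (auto simp: in_keys_iff lz split: if_splits)
  have "\<exists>d. singular_chain (Suc p) X d \<and> chain_boundary (Suc p) d = z b" if b: "b \<in> B" for b
  proof -
    have "chain_boundary p (z b) = 0"
    proof (rule poly_mapping_eqI)
      fix t
      have "(\<Sum>s\<in>?S. of_int (face_coeff p t s) * Poly_Mapping.lookup c s) = 0"
        using lookup_real_chain_boundary[OF q finite_keys subset_refl, of c t] bc by simp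
      then have "(\<Sum>s\<in>?S. face_coeff p t s * m b s) = 0"
        using b by (rule m)
      then show "Poly_Mapping.lookup (chain_boundary p (z b)) t = Poly_Mapping.lookup 0 t"
        using lookup_chain_boundary[OF q finite_keys kz[of b], of t] by (simp add: lz)
    qed
    moreover have "singular_chain p X (z b)"
      using kz S by (force simp: singular_chain_def)
    ultimately have "singular_relcycle p X {} (z b)"
      by (simp add: singular_cycle)
    then show ?thesis
      using X unfolding trivial_homology_group_iff singular_boundary by blast
  qed
  then obtain d where d: "\<And>b. b \<in> B \<Longrightarrow> singular_chain (Suc p) X (d b)"
      "\<And>b. b \<in> B \<Longrightarrow> chain_boundary (Suc p) (d b) = z b"
    by metis
  let ?e = "\<Sum>b\<in>B. real_multiple (w b) (d b)"
  have "real_chain_boundary (Suc p) ?e = (\<Sum>b\<in>B. real_multiple (w b) (z b))"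
    by (simp add: real_chain_boundary_sum real_chain_boundary_real_multiple d(2))
  also have "\<dots> = c"
  proof (rule poly_mapping_eqI)
    fix s
    show "Poly_Mapping.lookup (\<Sum>b\<in>B. real_multiple (w b) (z b)) s = Poly_Mapping.lookup c s"
    proof (cases "s \<in> ?S")
      case True
      then show ?thesis
        unfolding lookup_sum lookup_real_multiple lz by (simp only: if_True cw)
    next
      case False
      then show ?thesis
        unfolding lookup_sum lookup_real_multiple lz by (simp only: if_False) (simp add: in_keys_iff)
    qed
  qed
  finally have "c = real_chain_boundary (Suc p) ?e"
    by (rule sym)
  moreover have "?e \<in> carrier (real_chain_space (Suc p) X)"
    using d(1) by (rule carrier_real_chain_space_sum_multiple)
  ultimately show ?thesis
    unfolding real_boundaries_def by (rule image_eqI)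
qed

section \<open>Real homology as the image of a functional\<close>

lemma real_cycle_space_add:
  assumes "c \<in> carrier (real_cycle_space p X)" "d \<in> carrier (real_cycle_space p X)"
  shows "c + d \<in> carrier (real_cycle_space p X)"
  using assms keys_add[of c d]
  by (auto simp: real_cycle_space_def real_chain_space_def real_chain_boundary_add)

lemma real_cycle_space_map_mult:
  assumes "c \<in> carrier (real_cycle_space p X)"
  shows "Poly_Mapping.map ((*) r) c \<in> carrier (real_cycle_space p X)"
  using assms keys_map_mult[of r c]
  by (auto simp: real_cycle_space_def real_chain_space_def real_chain_boundary_map_mult
      poly_mapping_eqI lookup_map_mult)

text \<open>The first isomorphism theorem for a linear functional whose kernel is the boundaries; it
  is used for the zero functional and for the augmentation.\<close>

lemma module_isomorphic_real_homology:
  fixes p :: nat and X :: "'a topology" and \<phi> :: "'a real_chain \<Rightarrow> real"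
  defines "Z \<equiv> carrier (real_cycle_space p X)"
  assumes add: "\<And>c d. c \<in> Z \<Longrightarrow> d \<in> Z \<Longrightarrow> \<phi> (c + d) = \<phi> c + \<phi> d"
    and scale: "\<And>r c. c \<in> Z \<Longrightarrow> \<phi> (Poly_Mapping.map ((*) r) c) = r * \<phi> c"
    and ker: "real_boundaries p X = {c \<in> Z. \<phi> c = 0}"
  shows "module_isomorphic real_ring (real_homology p X) (real_line\<lparr>carrier := \<phi> ` Z\<rparr>)"
proof -
  let ?M = "real_cycle_space p X" and ?N = "real_boundaries p X"
  let ?H = "real_homology p X"
  \<comment> \<open>The cosets are exactly the fibres of \<open>\<phi>\<close>.\<close>
  define F where "F = (\<lambda>v. {c \<in> Z. \<phi> c = v})"
  \<comment> \<open>As \<open>\<phi>\<close> is constant on each coset, the chosen representative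
    does not matter.\<close>
  define h where "h = (\<lambda>A. \<phi> (SOME c. c \<in> A))"
  have Zadd: "c + d \<in> Z" if "c \<in> Z" "d \<in> Z" for c d
    using that unfolding Z_def by (rule real_cycle_space_add)
  have Zmap: "Poly_Mapping.map ((*) r) c \<in> Z" if "c \<in> Z" for r c
    using that unfolding Z_def by (rule real_cycle_space_map_mult)
  have neg: "Poly_Mapping.map ((*) (- 1)) c = - c" for c :: "'a real_chain"
    by (intro poly_mapping_eqI) (simp add: lookup_map_mult)
  have Zdiff: "c - d \<in> Z" "\<phi> (c - d) = \<phi> c - \<phi> d" if "c \<in> Z" "d \<in> Z" for c d
    using Zadd[OF that(1) Zmap[OF that(2), of "- 1"]] add[OF that(1) Zmap[OF that(2), of "- 1"]]
      scale[OF that(2), of "- 1"] by (simp_all add: neg)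
  have M: "add ?M = (+)" "smult ?M = (\<lambda>r. Poly_Mapping.map ((*) r))" "carrier ?M = Z"
    by (simp_all add: real_cycle_space_def real_chain_space_def Z_def)
  have shift: "{x + c |x. x \<in> F v} = F (v + \<phi> c)" if c: "c \<in> Z" for c v
  proof (intro equalityI subsetI)
    fix x assume "x \<in> F (v + \<phi> c)"
    then have "x - c \<in> F v" "x = (x - c) + c"
      using c Zdiff by (simp_all add: F_def)
    then show "x \<in> {x + c |x. x \<in> F v}"
      by blast
  qed (use c Zadd add in \<open>auto simp: F_def\<close>)
  have coset: "?N +>\<^bsub>?M\<^esub> c = F (\<phi> c)" if c: "c \<in> Z" for c
    using shift[OF c, of 0] by (auto simp: a_r_coset_def' M ker F_def)
  have carr: "carrier ?H = F ` \<phi> ` Z"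
    by (auto simp: real_homology_def quotient_module_def A_RCOSETS_def' M coset)
  have hF: "h (F v) = v" if "v \<in> \<phi> ` Z" for v
  proof -
    have "\<exists>c. c \<in> F v"
      using that by (auto simp: F_def)
    then have "(SOME c. c \<in> F v) \<in> F v"
      by (rule someI_ex)
    then show ?thesis
      by (simp add: h_def F_def)
  qed
  have addF: "F v \<oplus>\<^bsub>?H\<^esub> F w = F (v + w)" if w: "w \<in> \<phi> ` Z" for v w
  proof -
    obtain c where c: "c \<in> Z" "w = \<phi> c"
      using w by blast
    have "F v \<oplus>\<^bsub>?H\<^esub> F w = (\<Union>d\<in>F w. {x + d |x. x \<in> F v})"
      by (auto simp: real_homology_def quotient_module_def set_add_def' M)
    also have "\<dots> = (\<Union>d\<in>F w. F (v + w))"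
    proof (intro SUP_cong refl)
      fix d assume "d \<in> F w"
      then have "d \<in> Z" "\<phi> d = w"
        by (simp_all add: F_def)
      then show "{x + d |x. x \<in> F v} = F (v + w)"
        using shift by simp
    qed
    \<comment> \<open>The index set \<open>F w\<close> contains \<open>c\<close>, so this union of
      equal sets is not empty by accident.\<close>
    also have "\<dots> = F (v + w)"
      using c by (auto simp: F_def)
    finally show ?thesis .
  qed
  have smultF: "r \<odot>\<^bsub>?H\<^esub> F v = F (r * v)" if v: "v \<in> \<phi> ` Z" for r v
  proof -
    obtain c where c: "c \<in> Z" "v = \<phi> c"
      using v by blast
    have "r \<odot>\<^bsub>?H\<^esub> F v = (\<Union>d\<in>F v. ?N +>\<^bsub>?M\<^esub> Poly_Mapping.map ((*) r) d)"
      by (simp add: real_homology_def quotient_module_def M)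
    also have "\<dots> = (\<Union>d\<in>F v. F (r * v))"
    proof (intro SUP_cong refl)
      fix d assume "d \<in> F v"
      then show "?N +>\<^bsub>?M\<^esub> Poly_Mapping.map ((*) r) d = F (r * v)"
        by (subst coset) (auto simp: F_def Zmap scale)
    qed
    also have "\<dots> = F (r * v)"
      using c by (auto simp: F_def)
    finally show ?thesis .
  qed
  have closed: "v + w \<in> \<phi> ` Z" if "v \<in> \<phi> ` Z" "w \<in> \<phi> ` Z" for v w
    using that Zadd add by (metis (no_types, lifting) imageE imageI)
  have closed': "r * v \<in> \<phi> ` Z" if "v \<in> \<phi> ` Z" for r v
    using that Zmap scale by (metis (no_types, lifting) imageE imageI)
  let ?V = "real_line\<lparr>carrier := \<phi> ` Z\<rparr>"
  have "h \<in> iso (add_monoid ?H) (add_monoid ?V)"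
  proof (rule isoI)
    show "h \<in> hom (add_monoid ?H) (add_monoid ?V)"
    proof (rule homI)
      fix A assume "A \<in> carrier (add_monoid ?H)"
      then obtain v where "v \<in> \<phi> ` Z" "A = F v"
        using carr by auto
      then show "h A \<in> carrier (add_monoid ?V)"
        by (simp add: hF)
    next
      fix A B assume "A \<in> carrier (add_monoid ?H)" "B \<in> carrier (add_monoid ?H)"
      then obtain v w where "v \<in> \<phi> ` Z" "A = F v" "w \<in> \<phi> ` Z" "B = F w"
        using carr by auto
      then show "h (A \<otimes>\<^bsub>add_monoid ?H\<^esub> B) = h A \<otimes>\<^bsub>add_monoid ?V\<^esub> h B"
        by (simp add: addF hF closed real_line_def)
    qed
    show "bij_betw h (carrier (add_monoid ?H)) (carrier (add_monoid ?V))"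
      by (rule bij_betw_byWitness[of _ F]) (auto simp: carr hF)
  qed
  moreover have "h (r \<odot>\<^bsub>?H\<^esub> x) = r \<odot>\<^bsub>?V\<^esub> h x" if x: "x \<in> carrier ?H" for r x
  proof -
    obtain v where "v \<in> \<phi> ` Z" "x = F v"
      using x carr by blast
    then show ?thesis
      by (simp add: smultF hF closed' real_line_def)
  qed
  ultimately show ?thesis
    unfolding module_isomorphic_def by blast
qed

proposition real_homology_trivial:
  assumes "p > 0" "trivial_group (homology_group (int p) X)"
  shows "module_isomorphic real_ring (real_homology p X) zero_space"
proof -
  let ?Z = "carrier (real_cycle_space p X)"
  have "real_boundaries p X = {c \<in> ?Z. (0::real) = 0}"
    using real_cycle_in_real_boundaries[OF assms] real_boundaries_subset[of p X] by auto
  then have "module_isomorphic real_ring (real_homology p X) (real_line\<lparr>carrier := (\<lambda>_. 0) ` ?Z\<rparr>)"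
    by (intro module_isomorphic_real_homology) auto
  \<comment> \<open>A cycle must exist for the image of the zero functional to be
    \<open>{0}\<close>.\<close>
  moreover have "0 \<in> ?Z"
    by (simp add: real_cycle_space_def real_chain_space_def)
  then have "(\<lambda>_. 0 :: real) ` ?Z = {0}"
    by auto
  ultimately show ?thesis
    by (simp add: zero_space_def)
qed

section \<open>Degree zero and the augmentation\<close>

definition augmentation :: "'a real_chain \<Rightarrow> real" where
  "augmentation c = (\<Sum>s\<in>Poly_Mapping.keys c. Poly_Mapping.lookup c s)"

lemma augmentation_superset:
  assumes "finite A" "Poly_Mapping.keys c \<subseteq> A"
  shows "augmentation c = (\<Sum>s\<in>A. Poly_Mapping.lookup c s)"
  unfolding augmentation_def using assms by (intro sum.mono_neutral_left) (auto simp: in_keys_iff)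

lemma augmentation_add: "augmentation (c + d) = augmentation c + augmentation d"
proof -
  let ?A = "Poly_Mapping.keys c \<union> Poly_Mapping.keys d"
  show ?thesis
    by (simp add: augmentation_superset[of ?A] keys_add lookup_add sum.distrib)
qed

lemma augmentation_map_mult: "augmentation (Poly_Mapping.map ((*) r) c) = r * augmentation c"
  by (simp add: augmentation_superset[of "Poly_Mapping.keys c"] keys_map_mult lookup_map_mult sum_distrib_left)

lemma augmentation_single [simp]: "augmentation (Poly_Mapping.single s x) = x"
  by (simp add: augmentation_superset[of "{s}"])

lemma augmentation_sum: "augmentation (\<Sum>i\<in>I. c i) = (\<Sum>i\<in>I. augmentation (c i))"
  by (induction I rule: infinite_finite_induct) (simp_all add: augmentation_add, simp_all add: augmentation_def)

lemma augmentation_boundary: "augmentation (real_chain_boundary (Suc 0) d) = 0"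
  by (simp add: real_chain_boundary_def augmentation_sum augmentation_add)

text \<open>Each 0-simplex is homologous to the base point \<open>f\<close>, so a 0-chain differs
  from its augmentation times \<open>f\<close> by a boundary. The boundaries are thus the kernel of
  the augmentation.\<close>

proposition real_homology_0_path_connected:
  assumes X: "path_connected_space X" "topspace X \<noteq> {}"
  shows "module_isomorphic real_ring (real_homology 0 X) real_line"
proof -
  let ?Z = "carrier (real_cycle_space 0 X)"
  have Z: "?Z = {c. Poly_Mapping.keys c \<subseteq> singular_simplex_set 0 X}"
    by (auto simp: real_cycle_space_def real_chain_space_def real_chain_boundary_def)
  obtain a where a: "a \<in> topspace X"
    using X(2) by blast
  \<comment> \<open>The restriction makes the constant map extensional, as singular simplices must
    be.\<close>
  define f where "f = restrict (\<lambda>_. a) (standard_simplex 0)"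
  have f: "singular_simplex 0 X f"
    using a continuous_map_eq[of _ X "\<lambda>_. a" f] by (auto simp: singular_simplex_def f_def)
  have "\<exists>d. singular_chain (Suc 0) X d \<and> chain_boundary (Suc 0) d = frag_of s - frag_of f"
    if "singular_simplex 0 X s" for s
    using iso_integer_zeroth_homology_group_aux[OF X(1) that f]
    by (simp add: homologous_rel_def singular_boundary)
  then obtain d where d: "\<And>s. singular_simplex 0 X s \<Longrightarrow> singular_chain (Suc 0) X (d s)"
    "\<And>s. singular_simplex 0 X s \<Longrightarrow> chain_boundary (Suc 0) (d s) = frag_of s - frag_of f"
    by metis
  have "c \<in> real_boundaries 0 X" if c: "c \<in> ?Z" "augmentation c = 0" for c
  proof -
    let ?S = "Poly_Mapping.keys c"
    let ?e = "\<Sum>s\<in>?S. real_multiple (Poly_Mapping.lookup c s) (d s)"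
    have S: "singular_simplex 0 X s" if "s \<in> ?S" for s
      using that c(1) Z by auto
    have "real_chain_boundary (Suc 0) ?e =
        (\<Sum>s\<in>?S. real_multiple (Poly_Mapping.lookup c s) (frag_of s - frag_of f))"
      by (simp add: real_chain_boundary_sum real_chain_boundary_real_multiple d(2) S)
    also have "\<dots> = c"
    proof (rule poly_mapping_eqI)
      fix t
      have "Poly_Mapping.lookup (\<Sum>s\<in>?S. real_multiple (Poly_Mapping.lookup c s) (frag_of s - frag_of f)) t =
          (\<Sum>s\<in>?S. (if s = t then Poly_Mapping.lookup c s else 0) - (if f = t then Poly_Mapping.lookup c s else 0))"
        unfolding lookup_sum
        by (intro sum.cong refl) (simp add: lookup_real_multiple lookup_minus lookup_single when_def)
      also have "\<dots> = Poly_Mapping.lookup c t - (if f = t then augmentation c else 0)"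
        by (simp add: sum_subtractf augmentation_def in_keys_iff)
      finally show "Poly_Mapping.lookup (\<Sum>s\<in>?S. real_multiple (Poly_Mapping.lookup c s) (frag_of s - frag_of f)) t =
          Poly_Mapping.lookup c t"
        using c(2) by simp
    qed
    finally have "c = real_chain_boundary (Suc 0) ?e"
      by (rule sym)
    moreover have "?e \<in> carrier (real_chain_space (Suc 0) X)"
      using d(1)[OF S] by (rule carrier_real_chain_space_sum_multiple)
    ultimately show ?thesis
      unfolding real_boundaries_def by (rule image_eqI)
  qed
  moreover have "c \<in> ?Z \<and> augmentation c = 0" if "c \<in> real_boundaries 0 X" for c
    using that real_boundaries_subset[of 0 X] augmentation_boundary by (auto simp: real_boundaries_def)
  ultimately have "real_boundaries 0 X = {c \<in> ?Z. augmentation c = 0}"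
    by blast
  then have "module_isomorphic real_ring (real_homology 0 X) (real_line\<lparr>carrier := augmentation ` ?Z\<rparr>)"
    by (intro module_isomorphic_real_homology) (auto simp: augmentation_add augmentation_map_mult)
  moreover have "augmentation ` ?Z = UNIV"
  proof -
    have "x \<in> augmentation ` ?Z" for x
      using f by (intro image_eqI[of _ _ "Poly_Mapping.single f x"]) (auto simp: Z)
    then show ?thesis
      by blast
  qed
  ultimately show ?thesis
    by (simp add: real_line_def)
qed

theorem proposition1p4:
  fixes f :: "real ^ 'n \<Rightarrow> real ^ 'n"
    and \<Omega> \<Omega>' :: "(real ^ 'n) set"
    and y :: "real ^ 'n" and r :: real
  assumes n: "CARD('n) \<ge> 2"
    and dom: "open \<Omega>" "connected \<Omega>"
    and dom': "open \<Omega>'" "connected \<Omega>'"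
    and cont: "continuous_on \<Omega> f"
    and surj: "f ` \<Omega> = \<Omega>'"
    and mono: "monotone_map (top_of_set \<Omega>) (top_of_set \<Omega>') f"
    and proper: "\<forall>K. K \<subseteq> \<Omega>' \<and> compact K \<longrightarrow> compact (\<Omega> \<inter> f -` K)"
    and r: "r > 0"
    and ball: "compact (closure (ball y r))" "closure (ball y r) \<subseteq> \<Omega>'"
  shows "module_isomorphic real_ring
           (real_homology 0 (top_of_set (\<Omega> \<inter> f -` ball y r))) real_line \<and>
         module_isomorphic real_ring
           (real_homology (CARD('n) - 1) (top_of_set (\<Omega> \<inter> f -` ball y r))) zero_space \<and>
         module_isomorphic real_ring
           (real_homology (CARD('n)) (top_of_set (\<Omega> \<inter> f -` ball y r))) zero_space"
proof -
  define U where "U = \<Omega> \<inter> f -` ball y r"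
  have dim: "2 \<le> DIM(real ^ 'n)"
    using n by simp
  have sub: "cball y r \<subseteq> \<Omega>'"
    using ball(2) r by simp
  note U = monotone_proper_preimage_ball[OF dim dom(1) cont surj mono proper[rule_format, OF conjI] r sub,
      folded U_def]
  \<comment> \<open>Degree zero calls for path connectedness, which open connected sets
    have.\<close>
  have "path_connected_space (top_of_set U)"
    using connected_open_path_connected[OF U(1,4)]
    unfolding path_connectedin_euclidean[symmetric] path_connectedin_def by (rule conjunct2)
  then have "module_isomorphic real_ring (real_homology 0 (top_of_set U)) real_line"
    using U(3) by (intro real_homology_0_path_connected) auto
  \<comment> \<open>The assumption \<open>n\<close> makes both degrees positive, as the transfer to
    real coefficients requires.\<close>
  moreover have "module_isomorphic real_ring (real_homology (CARD('n) - 1) (top_of_set U)) zero_space"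
    "module_isomorphic real_ring (real_homology CARD('n) (top_of_set U)) zero_space"
    using trivial_homology_groups_connected_boundary[OF U(1-3,5-7) dim] n
    by (intro real_homology_trivial; simp)+
  ultimately show ?thesis
    unfolding U_def by blast
qed

end
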